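(* Let $d\ge 1$ be an integer and let $A_1,A_2,B_1,B_2,C_1,C_2,C_3$ be positive stable matrices in $\mathbb{C}^{d\times d}$ such that $\alpha(A_1)<\beta(C_1)$, $\alpha(A_2)<1$, $\alpha(B_1)<1$, $\alpha(B_2)<\beta(C_2)$ and $\beta(C_3)>1$. Let $r,s,t$ be positive real numbers with $r<1$, $s<1$ and $(1-r)(1-s)=t$. Then the series $$F_3(A_1,A_2,A_2,B_1,B_2,B_1;C_1,C_2,C_3;x,y,z)=\sum_{m,n,p=0}^{\infty}(A_1)_m(A_2)_{n+p}(B_1)_{m+p}(B_2)_n(C_1)_m^{-1}(C_2)_n^{-1}(C_3)_p^{-1}\,\frac{x^my^nz^p}{m!\,n!\,p!}$$ converges absolutely for all $x,y,z\in\mathbb{C}$ with $|x|<r$, $|y|<s$, $|z|<t$.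
   Context: For $M\in\mathbb{C}^{d\times d}$ with spectrum $\sigma(M)$, $\alpha(M)=\max\{\Re(w):w\in\sigma(M)\}$ and $\beta(M)=\min\{\Re(w):w\in\sigma(M)\}$; $M$ is positive stable if $\beta(M)>0$. The Pochhammer symbol is $(M)_0=I$ and $(M)_k=M(M+I)\cdots(M+(k-1)I)$ for $k\ge1$; $(M)_k^{-1}$ denotes the inverse matrix of $(M)_k$. Matrix products are taken in the written order (no commutativity is assumed). Absolute convergence means that the series of norms of the terms converges. *)

theory Defs
  imports "HOL-Analysis.Analysis"
begin

text \<open>
  Complex square matrices of size \<open>d\<close> are elements of \<open>complex^'d^'d\<close>, so that \<open>d = CARD('d) \<ge> 1\<close>.
\<close>

definition spectrum :: "complex^'d^'d \<Rightarrow> complex set" where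
  "spectrum M = {w. \<exists>v. v \<noteq> 0 \<and> M *v v = w *s v}"

text \<open>
  The spectrum is finite and nonempty, so \<open>Max\<close> and \<open>Min\<close> below are genuine.
\<close>

definition spec_max :: "complex^'d^'d \<Rightarrow> real" where  \<comment> \<open>written \<open>\<alpha>(M)\<close>\<close>
  "spec_max M = Max (Re ` spectrum M)"

definition spec_min :: "complex^'d^'d \<Rightarrow> real" where  \<comment> \<open>written \<open>\<beta>(M)\<close>\<close>
  "spec_min M = Min (Re ` spectrum M)"

definition positive_stable :: "complex^'d^'d \<Rightarrow> bool" where
  "positive_stable M \<longleftrightarrow> 0 < spec_min M"

text \<open>
  The library's \<open>pochhammer\<close> needs a commutative semiring, and \<open>*\<close> on \<open>complex^'d^'d\<close> is the
  componentwise product; \<open>mat c\<close> is the scalar matrix \<open>c I\<close>.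
\<close>

primrec mat_pochhammer :: "complex^'d^'d \<Rightarrow> nat \<Rightarrow> complex^'d^'d" where
  "mat_pochhammer M 0 = mat 1"
| "mat_pochhammer M (Suc k) = mat_pochhammer M k ** (M + mat (of_nat k))"

definition mat_scale :: "complex \<Rightarrow> complex^'d^'d \<Rightarrow> complex^'d^'d" where
  "mat_scale c M = (\<chi> i j. c * M $ i $ j)"

text \<open>
  The general term of \<open>F\<^sub>3(A\<^sub>1,A\<^sub>2,A\<^sub>2,B\<^sub>1,B\<^sub>2,B\<^sub>1;C\<^sub>1,C\<^sub>2,C\<^sub>3;x,y,z)\<close>; the repeated parameters
  \<open>A\<^sub>2\<close> and \<open>B\<^sub>1\<close> are passed once. The inverses \<open>matrix_inv\<close> are genuine for positive stable
  \<open>C\<^sub>1,C\<^sub>2,C\<^sub>3\<close>.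
\<close>

definition F3_term ::
  "complex^'d^'d \<Rightarrow> complex^'d^'d \<Rightarrow> complex^'d^'d \<Rightarrow> complex^'d^'d \<Rightarrow>
   complex^'d^'d \<Rightarrow> complex^'d^'d \<Rightarrow> complex^'d^'d \<Rightarrow>
   complex \<Rightarrow> complex \<Rightarrow> complex \<Rightarrow> nat \<Rightarrow> nat \<Rightarrow> nat \<Rightarrow> complex^'d^'d" where
  "F3_term A1 A2 B1 B2 C1 C2 C3 x y z m n p =
     mat_scale (x ^ m * y ^ n * z ^ p / (fact m * fact n * fact p))
       (mat_pochhammer A1 m ** mat_pochhammer A2 (n + p)
        ** mat_pochhammer B1 (m + p) ** mat_pochhammer B2 n
        ** matrix_inv (mat_pochhammer C1 m)
        ** matrix_inv (mat_pochhammer C2 n)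
        ** matrix_inv (mat_pochhammer C3 p))"

end

theory Submission
  imports Defs "HOL-Computational_Algebra.Fundamental_Theorem_Algebra"
begin

text \<open>
  Let \<open>A\<close> have all eigenvalues of real part below \<open>a > 0\<close>, and \<open>C\<close> all eigenvalues of real part
  above \<open>c > 0\<close>. Up to a constant, the Pochhammer symbol of the matrix is then no worse than that
  of the number: \<open>\<parallel>(A)\<^sub>k\<parallel> \<le> K (a)\<^sub>k\<close> (\<open>mat_pochhammer_onorm_le\<close>) and \<open>\<parallel>(C)\<^sub>k\<inverse>\<parallel> \<le> K / (c)\<^sub>k\<close>
  (\<open>mat_pochhammer_inv_onorm_le\<close>). Under the spectral hypotheses one number can serve as the
  bound for both \<open>A\<^sub>1\<close> and \<open>C\<^sub>1\<close>, and another for both \<open>B\<^sub>2\<close> and \<open>C\<^sub>2\<close>, so these pairs cancel,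
  while \<open>A\<^sub>2\<close>, \<open>B\<^sub>1\<close> and \<open>C\<^sub>3\<close> are compared with \<open>(1)\<^sub>k = k!\<close>. The norms of the factors are
  multiplied, so their order does not matter. The general term is therefore at most a constant times
  \<open>binom(m+p,p) binom(n+p,p) |x|\<^sup>m |y|\<^sup>n |z|\<^sup>p\<close>. The negative binomial series sums this over \<open>m\<close>
  and \<open>n\<close> to \<open>|z|\<^sup>p / ((1-|x|)(1-|y|))\<^sup>p\<^sup>+\<^sup>1\<close>, a geometric series in \<open>p\<close>,
  which converges because \<open>|z| < (1-r)(1-s) < (1-|x|)(1-|y|)\<close>.

  The Pochhammer bounds need a norm \<open>N\<close> in which \<open>A + k I\<close> is controlled by the numbers
  \<open>|\<lambda> + k|\<close>, where \<open>\<lambda>\<close> runs through the eigenvalues, with an error that is small uniformly in \<open>k\<close>.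
  Such a norm is usually read off a triangular form with small off-diagonal part. Here it is built
  without a change of basis: take eigenvalues \<open>\<lambda>\<^sub>1,\<dots>,\<lambda>\<^sub>q\<close> with \<open>(A - \<lambda>\<^sub>1)\<cdots>(A - \<lambda>\<^sub>q) = 0\<close> and put
  \<open>N(v) = \<Sum>\<^sub>i\<^sub><\<^sub>q e\<^sup>-\<^sup>i \<parallel>(A - \<lambda>\<^sub>1)\<cdots>(A - \<lambda>\<^sub>i) v\<parallel>\<close>. If \<open>w\<^sub>i\<close> denotes the vector in the \<open>i\<close>-th summand,
  then \<open>(A + k) w\<^sub>i = (\<lambda>\<^sub>i\<^sub>+\<^sub>1 + k) w\<^sub>i + w\<^sub>i\<^sub>+\<^sub>1\<close> with \<open>w\<^sub>q = 0\<close>, and the weights make the second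
  terms contribute at most \<open>e N(v)\<close> altogether (\<open>adapted_norm_shift_le\<close>, \<open>adapted_norm_shift_ge\<close>).
\<close>

section \<open>Annihilating products of linear factors\<close>

lemma norm_vector_smult: "norm (c *s v) = norm c * norm v"
  for c :: complex and v :: "complex^'d"
  by (simp add: norm_vec_def norm_mult L2_set_right_distrib)

lemma mat_mult_vec: "mat c *v v = c *s v" for c :: complex and v :: "complex^'d"
  by (simp add: matrix_vector_mult_def mat_def vec_eq_iff if_distrib if_distribR sum.delta cong: if_cong)

lemma scaleR_matrix_mult_vec: "(c *\<^sub>R M) *v v = c *\<^sub>R (M *v v)"
  for M :: "complex^'d^'d"
  by (simp add: vec_eq_iff matrix_vector_mult_def scaleR_sum_right)

text \<open>
  Evaluation of a polynomial at a matrix, as an action on vectors: the type of matrices carries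
  no ring structure whose product is matrix multiplication.
\<close>
definition poly_act :: "complex^'d^'d \<Rightarrow> complex poly \<Rightarrow> complex^'d \<Rightarrow> complex^'d" where
  "poly_act A p v = (\<Sum>i\<le>degree p. coeff p i *s (((*v) A ^^ i) v))"

lemma poly_act_eq_sum:
  assumes "degree p \<le> n"
  shows "poly_act A p v = (\<Sum>i\<le>n. coeff p i *s (((*v) A ^^ i) v))"
  unfolding poly_act_def
  using assms by (intro sum.mono_neutral_left) (auto simp: coeff_eq_0)

lemma poly_act_add: "poly_act A (p + q) v = poly_act A p v + poly_act A q v"
proof -
  define n where "n = max (degree p) (degree q)"
  have "degree (p + q) \<le> n" "degree p \<le> n" "degree q \<le> n"
    by (auto simp: n_def intro: degree_add_le)
  then show ?thesis
    by (simp add: poly_act_eq_sum sum.distrib vec.scale_left_distrib)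
qed

lemma poly_act_smult: "poly_act A (smult c p) v = c *s poly_act A p v"
  by (simp add: poly_act_eq_sum[OF degree_smult_le] poly_act_def vec.scale_sum_right)

lemma poly_act_pCons_0: "poly_act A (pCons 0 p) v = A *v poly_act A p v"
proof -
  have "poly_act A (pCons 0 p) v
      = (\<Sum>i\<le>Suc (degree p). coeff (pCons 0 p) i *s (((*v) A ^^ i) v))"
    by (intro poly_act_eq_sum) (simp add: degree_pCons_le)
  also have "\<dots> = (\<Sum>i\<le>degree p. coeff p i *s (A *v ((*v) A ^^ i) v))"
    by (subst sum.atMost_Suc_shift) simp
  also have "\<dots> = A *v poly_act A p v"
    by (simp add: poly_act_def vec.linear_sum matrix_vector_mul_linear_gen vector_scalar_commute
        vec.linear_sum[OF matrix_vector_mul_linear_gen])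
  finally show ?thesis .
qed

abbreviation shift_apply :: "complex^'d^'d \<Rightarrow> complex \<Rightarrow> complex^'d \<Rightarrow> complex^'d" where
  "shift_apply A l v \<equiv> A *v v - l *s v"

abbreviation root_prod :: "complex^'d^'d \<Rightarrow> complex list \<Rightarrow> complex^'d \<Rightarrow> complex^'d" where
  "root_prod A ls \<equiv> fold (shift_apply A) ls"

lemma root_prod_shift:
  "root_prod A ls (shift_apply A l v) = shift_apply A l (root_prod A ls v)"
proof (induction ls arbitrary: v)
  case (Cons k ls)
  have "shift_apply A k (shift_apply A l v) = shift_apply A l (shift_apply A k v)"
    by (simp add: matrix_vector_mult_diff_distrib vector_scalar_commute
        vec.scale_right_diff_distrib mult.commute)
  then show ?case
    using Cons by (simp only: fold_simps)
qed simp

lemma root_prod_zero [simp]: "root_prod A ls 0 = 0"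
  by (induction ls) simp_all

lemma poly_act_linear_factors:
  "poly_act A (\<Prod>l\<leftarrow>ls. [:-l, 1:]) v = root_prod A ls v"
proof (induction ls)
  case Nil
  show ?case
    by (simp add: poly_act_def)
next
  case (Cons l ls)
  let ?q = "\<Prod>k\<leftarrow>ls. [:-k, 1:]"
  have "poly_act A ([:-l, 1:] * ?q) v = poly_act A (smult (-l) ?q + pCons 0 ?q) v"
    by (simp add: mult_pCons_left)
  also have "\<dots> = shift_apply A l (root_prod A ls v)"
    using Cons by (simp only: poly_act_add poly_act_smult poly_act_pCons_0) simp
  finally show ?case
    by (simp add: root_prod_shift)
qed

text \<open>
  The powers of a matrix lie in a finite-dimensional space. A real relation is enough, so the
  Euclidean dimension of the matrix space can be used; the case of two equal powers is separate
  because linear dependence is a property of the set of powers and not of the family.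
\<close>
lemma ex_linear_relation_powers:
  fixes A :: "complex^'d^'d"
  shows "\<exists>(c :: nat \<Rightarrow> complex) n. (\<exists>i\<le>n. c i \<noteq> 0) \<and>
           (\<forall>v. (\<Sum>i\<le>n. c i *s (((*v) A ^^ i) v)) = 0)"
proof -
  define P where "P i = ((**) A ^^ i) (mat 1)" for i
  have P: "P i *v v = ((*v) A ^^ i) v" for i v
    by (induction i) (simp_all add: P_def matrix_vector_mul_assoc[symmetric])
  define n where "n = DIM(complex^'d^'d)"
  show ?thesis
  proof (cases "inj_on P {..n}")
    case True
    then have "dependent (P ` {..n})"
      by (intro dependent_biggerset) (simp add: card_image n_def)
    then obtain t u where t: "finite t" "t \<subseteq> P ` {..n}" "(\<Sum>M\<in>t. u M *\<^sub>R M) = 0"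
      and nz: "\<exists>M\<in>t. u M \<noteq> 0"
      unfolding dependent_explicit by blast
    define c where "c i = complex_of_real (if P i \<in> t then u (P i) else 0)" for i
    have "(\<Sum>i\<le>n. c i *s (((*v) A ^^ i) v)) = 0" for v
    proof -
      have "(\<Sum>i\<le>n. c i *s (((*v) A ^^ i) v))
          = (\<Sum>i\<le>n. (if P i \<in> t then u (P i) else 0) *\<^sub>R (P i *v v))"
        unfolding P c_def by (intro sum.cong refl) (simp add: vec_eq_iff scaleR_conv_of_real[where 'a = complex])
      also have "\<dots> = (\<Sum>M\<in>P ` {..n}. (if M \<in> t then u M else 0) *\<^sub>R (M *v v))"
        by (simp add: sum.reindex[OF True])
      also have "\<dots> = (\<Sum>M\<in>t. u M *\<^sub>R (M *v v))"
        using t(2) by (intro sum.mono_neutral_cong_right) auto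
      also have "\<dots> = (\<Sum>M\<in>t. u M *\<^sub>R M) *v v"
        using t(1)
        by (induction t rule: finite_induct)
          (simp_all add: matrix_vector_mult_add_rdistrib scaleR_matrix_mult_vec)
      finally show ?thesis
        using t(3) by simp
    qed
    moreover have "\<exists>i\<le>n. c i \<noteq> 0"
      using nz t(2) by (force simp: c_def)
    ultimately show ?thesis
      by blast
  next
    case False
    then obtain i j where ij: "i \<le> n" "j \<le> n" "i \<noteq> j" "P i = P j"
      by (auto simp: inj_on_def)
    define c where "c k = (if k = i then 1 else if k = j then -1 else 0 :: complex)" for k
    have "(\<Sum>k\<le>n. c k *s (((*v) A ^^ k) v)) = 0" for v
    proof -
      have "(\<Sum>k\<le>n. c k *s (((*v) A ^^ k) v)) = (\<Sum>k\<in>{i, j}. c k *s (P k *v v))"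
        unfolding P using ij by (intro sum.mono_neutral_right) (auto simp: c_def)
      then show ?thesis
        using ij by (simp add: c_def)
    qed
    moreover have "\<exists>k\<le>n. c k \<noteq> 0"
      using ij by (auto simp: c_def)
    ultimately show ?thesis
      by blast
  qed
qed

text \<open>
  A linear relation between powers of \<open>A\<close> is a nonzero polynomial that kills \<open>A\<close>; over \<open>\<complex>\<close> it
  splits into linear factors.
\<close>
lemma ex_annihilating_roots: "\<exists>ls. \<forall>v. root_prod A ls v = 0"
proof -
  obtain c :: "nat \<Rightarrow> complex" and n j where c: "j \<le> n" "c j \<noteq> 0"
    "\<And>v. (\<Sum>i\<le>n. c i *s (((*v) A ^^ i) v)) = 0"
    using ex_linear_relation_powers[of A] by blast
  define p where "p = (\<Sum>i\<le>n. monom (c i) i)"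
  have coeff_p: "coeff p i = (if i \<le> n then c i else 0)" for i
    by (simp add: p_def coeff_sum)
  have "p \<noteq> 0"
    using c(1,2) coeff_p[of j] by auto
  then obtain R where R: "p = smult (lead_coeff p) (\<Prod>x\<in>#R. [:-x, 1:])"
    using alg_closed_imp_factorization by blast
  obtain ls where ls: "mset ls = R"
    using ex_mset by blast
  have p_eq: "p = smult (lead_coeff p) (\<Prod>x\<leftarrow>ls. [:-x, 1:])"
    using R ls by (metis mset_map prod_mset_prod_list)
  have "root_prod A ls v = 0" for v
  proof -
    have "degree p \<le> n"
      by (intro degree_le) (simp add: coeff_p)
    then have "poly_act A p v = 0"
      using c(3) by (simp add: poly_act_eq_sum coeff_p)
    then have "lead_coeff p *s root_prod A ls v = 0"
      by (subst (asm) p_eq) (simp only: poly_act_smult poly_act_linear_factors)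
    then show ?thesis
      using \<open>p \<noteq> 0\<close> by simp
  qed
  then show ?thesis
    by blast
qed

text \<open>
  For a number \<open>l\<close> outside the spectrum \<open>A - l I\<close> is injective, so this factor can be cancelled.
\<close>
lemma root_prod_filter_spectrum:
  assumes "root_prod A ls v = 0"
  shows "root_prod A (filter (\<lambda>l. l \<in> spectrum A) ls) v = 0"
  using assms
proof (induction ls arbitrary: v)
  case (Cons l ls)
  let ?ms = "filter (\<lambda>l. l \<in> spectrum A) ls"
  have *: "root_prod A ?ms (shift_apply A l v) = 0"
    using Cons by simp
  show ?case
  proof (cases "l \<in> spectrum A")
    case False
    have "shift_apply A l (root_prod A ?ms v) = 0"
      using * by (simp add: root_prod_shift)
    then have "root_prod A ?ms v = 0"
      using False by (auto simp: spectrum_def)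
    then show ?thesis
      using False by simp
  qed (use * in simp)
qed simp

lemma root_prod_eigenvector:
  assumes "A *v v = w *s v"
  shows "root_prod A ls v = (\<Prod>l\<leftarrow>ls. w - l) *s v"
proof (induction ls)
  case (Cons l ls)
  have "root_prod A (l # ls) v = shift_apply A l (root_prod A ls v)"
    by (simp add: root_prod_shift)
  also have "\<dots> = (\<Prod>k\<leftarrow>l # ls. w - k) *s v"
    using Cons assms by (simp add: vector_scalar_commute algebra_simps vec.scale_left_diff_distrib)
  finally show ?case .
qed simp

text \<open>
  Besides the list on which the adapted norm is built, this shows that the spectrum is finite and
  nonempty, so that its extreme real parts are attained: an eigenvector for \<open>w\<close> is multiplied by
  \<open>\<Prod>(w - l)\<close>, which must vanish, and an empty product would be the identity.
\<close>
lemma ex_annihilating_spectrum_list: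
  fixes A :: "complex^'d^'d"
  obtains ls where "\<And>v. root_prod A ls v = 0" and "set ls = spectrum A" and "ls \<noteq> []"
proof -
  obtain ks where ks: "\<And>v. root_prod A ks v = 0"
    using ex_annihilating_roots[of A] by blast
  define ls where "ls = filter (\<lambda>l. l \<in> spectrum A) ks"
  have ls: "root_prod A ls v = 0" for v
    unfolding ls_def using ks by (rule root_prod_filter_spectrum)
  moreover have "spectrum A \<subseteq> set ls"
  proof
    fix w assume "w \<in> spectrum A"
    then obtain v where v: "v \<noteq> 0" "A *v v = w *s v"
      by (auto simp: spectrum_def)
    then have "(\<Prod>l\<leftarrow>ls. w - l) = 0"
      using ls[of v] root_prod_eigenvector[of A v w ls] by simp
    then show "w \<in> set ls"
      by (auto simp: prod_list_zero_iff)
  qed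
  moreover have "ls \<noteq> []"
    using ls[of "axis undefined 1"] by (auto simp: axis_eq_0_iff)
  ultimately show ?thesis
    by (intro that[of ls]) (auto simp: ls_def)
qed

lemma finite_spectrum: "finite (spectrum A)" and spectrum_nonempty: "spectrum A \<noteq> {}"
  by (metis ex_annihilating_spectrum_list List.finite_set set_empty)+

lemma spec_min_le: "l \<in> spectrum A \<Longrightarrow> spec_min A \<le> Re l"
  unfolding spec_min_def using finite_spectrum by (intro Min_le) auto

lemma spec_max_ge: "l \<in> spectrum A \<Longrightarrow> Re l \<le> spec_max A"
  unfolding spec_max_def using finite_spectrum by (intro Max_ge) auto

lemma spec_min_le_spec_max: "spec_min A \<le> spec_max A"
  using spectrum_nonempty[of A] spec_min_le spec_max_ge by fastforce

section \<open>A norm adapted to the spectrum\<close>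

text \<open>
  Unfolded, this is \<open>\<Sum>\<^sub>i e\<^sup>-\<^sup>i \<parallel>(A - l\<^sub>i)\<cdots>(A - l\<^sub>1) v\<parallel>\<close>, with \<open>i\<close> running from \<open>0\<close> to one less than
  the length of the list. The product of all factors is left out; in the uses below it kills \<open>v\<close>.
\<close>
primrec adapted_norm :: "complex^'d^'d \<Rightarrow> real \<Rightarrow> complex list \<Rightarrow> complex^'d \<Rightarrow> real" where
  "adapted_norm A e [] v = 0"
| "adapted_norm A e (l # ls) v = norm v + adapted_norm A e ls (shift_apply A l v) / e"

lemma adapted_norm_nonneg: "0 < e \<Longrightarrow> 0 \<le> adapted_norm A e ls v"
  by (induction ls arbitrary: v) simp_all

lemma norm_le_adapted_norm: "0 < e \<Longrightarrow> ls \<noteq> [] \<Longrightarrow> norm v \<le> adapted_norm A e ls v"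
  by (cases ls) (simp_all add: adapted_norm_nonneg)

lemma adapted_norm_le_norm:
  assumes "0 < e"
  shows "\<exists>K>0. \<forall>v. adapted_norm A e ls v \<le> K * norm v"
proof (induction ls)
  case Nil
  show ?case
    by (intro exI[of _ 1]) simp
next
  case (Cons l ls)
  then obtain K where K: "0 < K" "\<And>v. adapted_norm A e ls v \<le> K * norm v"
    by blast
  define L where "L = onorm ((*v) A) + norm l"
  have "0 \<le> L"
    by (simp add: L_def onorm_pos_le)
  have L: "norm (shift_apply A l v) \<le> L * norm v" for v
  proof -
    have "norm (shift_apply A l v) \<le> norm (A *v v) + norm (l *s v)"
      by (rule norm_triangle_ineq4)
    also have "\<dots> \<le> L * norm v"
      using onorm[OF matrix_vector_mul_bounded_linear, of A v]
      by (simp add: L_def norm_vector_smult algebra_simps)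
    finally show ?thesis .
  qed
  have "adapted_norm A e (l # ls) v \<le> (1 + K * L / e) * norm v" for v
  proof -
    have "adapted_norm A e ls (shift_apply A l v) \<le> K * (L * norm v)"
      using K(2)[of "shift_apply A l v"] L[of v] K(1)
      by (meson mult_left_mono less_imp_le order_trans)
    then show ?thesis
      using assms by (simp add: field_simps)
  qed
  moreover have "0 < 1 + K * L / e"
    using K(1) \<open>0 \<le> L\<close> assms by (simp add: add_pos_nonneg)
  ultimately show ?case
    by blast
qed

lemma shift_apply_commute:
  "shift_apply A l (A *v v + c *s v) = A *v shift_apply A l v + c *s shift_apply A l v"
  by (simp add: matrix_vector_mult_diff_distrib matrix_vector_right_distrib vector_scalar_commute
      vec.scale_right_diff_distrib vec.scale_right_distrib mult.commute)

text \<open>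
  The summands after the first one occur twice, once with the factor \<open>\<rho>\<close> and once shifted by one
  place and hence with the factor \<open>e\<close>. Keeping \<open>- norm v\<close> in the bound instead of estimating
  \<open>e * (N v - norm v)\<close> by \<open>e * N v\<close> is what lets the induction on the list go through: it pays for
  the term \<open>norm (A v - l v)\<close> that the next longer list produces.
\<close>
lemma adapted_norm_shift_le:
  assumes "0 < e" and "root_prod A ls v = 0" and "\<And>l. l \<in> set ls \<Longrightarrow> norm (l + c) \<le> \<rho>"
  shows "adapted_norm A e ls (A *v v + c *s v)
           \<le> \<rho> * adapted_norm A e ls v + e * (adapted_norm A e ls v - norm v)"
  using assms(2,3)
proof (induction ls arbitrary: v)
  case (Cons l ls)
  let ?v = "shift_apply A l v"
  have "A *v v + c *s v = (l + c) *s v + ?v"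
    by (simp add: vec.scale_left_distrib)
  then have "norm (A *v v + c *s v) \<le> norm (l + c) * norm v + norm ?v"
    by (metis norm_triangle_ineq norm_vector_smult)
  also have "\<dots> \<le> \<rho> * norm v + norm ?v"
    using Cons.prems(2)[of l] by (simp add: mult_right_mono)
  finally have 1: "norm (A *v v + c *s v) \<le> \<rho> * norm v + norm ?v" .
  have IH: "adapted_norm A e ls (A *v ?v + c *s ?v)
      \<le> \<rho> * adapted_norm A e ls ?v + e * (adapted_norm A e ls ?v - norm ?v)"
    by (rule Cons.IH) (use Cons.prems in auto)
  have "adapted_norm A e ls (A *v ?v + c *s ?v) / e
      \<le> (\<rho> * adapted_norm A e ls ?v + e * (adapted_norm A e ls ?v - norm ?v)) / e"
    using assms(1) by (intro divide_right_mono IH) simp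
  also have "\<dots> = \<rho> * (adapted_norm A e ls ?v / e) + adapted_norm A e ls ?v - norm ?v"
    using assms(1) by (simp add: field_simps)
  finally have "adapted_norm A e (l # ls) (A *v v + c *s v)
      \<le> \<rho> * norm v + \<rho> * (adapted_norm A e ls ?v / e) + adapted_norm A e ls ?v"
    unfolding adapted_norm.simps shift_apply_commute using 1 by linarith
  then show ?case
    using assms(1) by (simp add: algebra_simps)
qed simp

lemma adapted_norm_shift_ge:
  assumes "0 < e" and "root_prod A ls v = 0" and "\<And>l. l \<in> set ls \<Longrightarrow> \<rho> \<le> norm (l + c)"
  shows "\<rho> * adapted_norm A e ls v - e * (adapted_norm A e ls v - norm v)
           \<le> adapted_norm A e ls (A *v v + c *s v)"
  using assms(2,3)
proof (induction ls arbitrary: v)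
  case (Cons l ls)
  let ?v = "shift_apply A l v"
  have "A *v v + c *s v = (l + c) *s v + ?v"
    by (simp add: vec.scale_left_distrib)
  then have "norm (l + c) * norm v - norm ?v \<le> norm (A *v v + c *s v)"
    by (metis norm_diff_ineq norm_vector_smult)
  moreover have "\<rho> * norm v \<le> norm (l + c) * norm v"
    using Cons.prems(2)[of l] by (simp add: mult_right_mono)
  ultimately have 1: "\<rho> * norm v - norm ?v \<le> norm (A *v v + c *s v)"
    by linarith
  have IH: "\<rho> * adapted_norm A e ls ?v - e * (adapted_norm A e ls ?v - norm ?v)
      \<le> adapted_norm A e ls (A *v ?v + c *s ?v)"
    by (rule Cons.IH) (use Cons.prems in auto)
  have "\<rho> * (adapted_norm A e ls ?v / e) - adapted_norm A e ls ?v + norm ?v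
      = (\<rho> * adapted_norm A e ls ?v - e * (adapted_norm A e ls ?v - norm ?v)) / e"
    using assms(1) by (simp add: field_simps)
  also have "\<dots> \<le> adapted_norm A e ls (A *v ?v + c *s ?v) / e"
    using assms(1) by (intro divide_right_mono IH) simp
  finally have "\<rho> * norm v + \<rho> * (adapted_norm A e ls ?v / e) - adapted_norm A e ls ?v
      \<le> adapted_norm A e (l # ls) (A *v v + c *s v)"
    unfolding adapted_norm.simps shift_apply_commute using 1 by linarith
  then show ?case
    using assms(1) by (simp add: algebra_simps)
qed simp

section \<open>Growth of matrix Pochhammer symbols\<close>

text \<open>
  \<open>\<bar>l + k\<bar> - k\<close> tends to \<open>Re l\<close>, since the imaginary part contributes only \<open>O(1/k)\<close>.
\<close>
lemma eventually_norm_add_of_nat_le: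
  fixes l :: complex
  assumes "Re l < a"
  shows "\<forall>\<^sub>F k in sequentially. norm (l + of_nat k) \<le> a + real k"
proof -
  define d where "d = a - Re l"
  have "0 < d"
    using assms by (simp add: d_def)
  have "\<forall>\<^sub>F k in sequentially. \<bar>Re l\<bar> + (Im l)\<^sup>2 / (2 * d) \<le> real k"
    using filterlim_real_sequentially by (auto simp: filterlim_at_top)
  then show ?thesis
  proof eventually_elim
    case (elim k)
    define u where "u = Re l + real k"
    have "(Im l)\<^sup>2 / (2 * d) \<le> u"
      using elim by (simp add: u_def)
    then have "(Im l)\<^sup>2 \<le> 2 * d * u"
      using \<open>0 < d\<close> by (simp add: field_simps)
    then have "u\<^sup>2 + (Im l)\<^sup>2 \<le> (u + d)\<^sup>2"
      by (simp add: power2_sum algebra_simps add_increasing)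
    moreover have "0 \<le> u + d"
      using \<open>(Im l)\<^sup>2 / (2 * d) \<le> u\<close> \<open>0 < d\<close> by (smt (verit) divide_nonneg_pos zero_le_power2)
    ultimately have "sqrt (u\<^sup>2 + (Im l)\<^sup>2) \<le> u + d"
      by (rule real_le_lsqrt[rotated])
    then show ?case
      by (simp add: cmod_def u_def d_def)
  qed
qed

lemma add_mat_mult_vec: "(A + mat c) *v v = A *v v + c *s v"
  for A :: "complex^'d^'d"
  by (simp add: matrix_vector_mult_add_rdistrib mat_mult_vec)

text \<open>
  From some index \<open>n\<close> on, multiplication by \<open>A + k I\<close> increases the adapted norm by a factor of at
  most \<open>a + k\<close>, which is exactly the quotient of consecutive scalar Pochhammer symbols. The finitely
  many earlier symbols only affect the constant.
\<close>
lemma mat_pochhammer_onorm_le: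
  fixes A :: "complex^'d^'d"
  assumes "0 < a" and "spec_max A < a"
  obtains K where "0 \<le> K" and "\<And>k. onorm ((*v) (mat_pochhammer A k)) \<le> K * pochhammer a k"
proof -
  obtain ls where ls: "\<And>v. root_prod A ls v = 0" "set ls = spectrum A" "ls \<noteq> []"
    using ex_annihilating_spectrum_list[of A] by metis
  \<comment> \<open>Half of the gap absorbs the error term of the adapted norm, the other half the difference
    between \<open>\<bar>l + k\<bar>\<close> and \<open>Re l + k\<close>.\<close>
  define e where "e = (a - spec_max A) / 2"
  have "0 < e"
    using assms by (simp add: e_def)
  define N where "N = adapted_norm A e ls"
  have N0: "norm v \<le> N v" "0 \<le> N v" for v
    using \<open>0 < e\<close> ls(3) by (auto simp: N_def norm_le_adapted_norm adapted_norm_nonneg)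
  obtain K1 where K1: "0 < K1" "\<And>v. N v \<le> K1 * norm v"
    using adapted_norm_le_norm[OF \<open>0 < e\<close>, of A ls] unfolding N_def by blast
  have "\<forall>\<^sub>F k in sequentially. \<forall>l\<in>set ls. norm (l + of_nat k) \<le> (a - e) + real k"
  proof (intro eventually_ball_finite ballI eventually_norm_add_of_nat_le)
    fix l assume "l \<in> set ls"
    then have "Re l \<le> spec_max A"
      using ls(2) by (simp add: spec_max_ge)
    then show "Re l < a - e"
      using assms by (simp add: e_def field_simps)
  qed simp
  then obtain n where n: "\<And>k l. n \<le> k \<Longrightarrow> l \<in> set ls \<Longrightarrow> norm (l + of_nat k) \<le> (a - e) + real k"
    by (auto simp: eventually_sequentially)
  have shift_le: "N (A *v v + of_nat k *s v) \<le> (a + real k) * N v" if "n \<le> k" for k v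
  proof -
    have "N (A *v v + of_nat k *s v) \<le> ((a - e) + real k) * N v + e * (N v - norm v)"
      unfolding N_def using \<open>0 < e\<close> ls(1) n[OF that] by (intro adapted_norm_shift_le) auto
    also have "\<dots> \<le> (a + real k) * N v"
      using \<open>0 < e\<close> by (simp add: algebra_simps)
    finally show ?thesis .
  qed
  have pos: "0 < pochhammer a k" for k
    using assms(1) by (rule pochhammer_pos)
  define B where "B k = onorm ((*v) (mat_pochhammer A k))" for k
  have B0: "0 \<le> B k" for k
    by (simp add: B_def onorm_pos_le)
  define K where "K = (\<Sum>k\<le>n. B k / pochhammer a k)"
  have "0 \<le> K"
    unfolding K_def using B0 pos by (intro sum_nonneg) (simp add: less_imp_le)
  have initial: "B k \<le> K * pochhammer a k" if "k \<le> n" for k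
  proof -
    have "B k / pochhammer a k \<le> K"
      unfolding K_def using that B0 pos
      by (intro member_le_sum) (auto simp: less_imp_le)
    then show ?thesis
      using pos by (simp add: pos_divide_le_eq)
  qed
  have tail: "norm (mat_pochhammer A k *v v) \<le> K * pochhammer a k * N v" if "n \<le> k" for k v
    using that
  proof (induction k arbitrary: v rule: dec_induct)
    case base
    have "norm (mat_pochhammer A n *v v) \<le> B n * norm v"
      unfolding B_def by (intro onorm matrix_vector_mul_bounded_linear)
    also have "\<dots> \<le> K * pochhammer a n * N v"
      using initial[of n] N0 B0 by (intro mult_mono) (auto intro: order_trans)
    finally show ?case .
  next
    case (step k)
    have "norm (mat_pochhammer A (Suc k) *v v)
        \<le> K * pochhammer a k * N (A *v v + of_nat k *s v)"
      using step.IH by (simp add: matrix_vector_mul_assoc[symmetric] add_mat_mult_vec)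
    also have "\<dots> \<le> K * pochhammer a k * ((a + real k) * N v)"
      using \<open>0 \<le> K\<close> pos step.hyps
      by (intro mult_left_mono shift_le mult_nonneg_nonneg) (auto simp: less_imp_le)
    finally show ?case
      by (simp add: pochhammer_Suc mult_ac)
  qed
  have "B k \<le> (K + K * K1) * pochhammer a k" for k
  proof (cases "k \<le> n")
    case True
    have "K * pochhammer a k \<le> (K + K * K1) * pochhammer a k"
      using \<open>0 \<le> K\<close> K1(1) pos[of k] by (intro mult_right_mono) auto
    then show ?thesis
      using initial[OF True] by linarith
  next
    case False
    have "norm (mat_pochhammer A k *v v) \<le> (K * pochhammer a k * K1) * norm v" for v
    proof -
      have "norm (mat_pochhammer A k *v v) \<le> K * pochhammer a k * N v"
        using False by (intro tail) simp
      also have "\<dots> \<le> K * pochhammer a k * (K1 * norm v)"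
        using \<open>0 \<le> K\<close> pos[of k] K1(2) by (intro mult_left_mono) auto
      finally show ?thesis
        by (simp add: mult_ac)
    qed
    then have "B k \<le> K * pochhammer a k * K1"
      unfolding B_def by (rule onorm_le)
    then show ?thesis
      using \<open>0 \<le> K\<close> pos[of k] by (simp add: algebra_simps add_increasing)
  qed
  moreover have "0 \<le> K + K * K1"
    using \<open>0 \<le> K\<close> K1(1) by simp
  ultimately show ?thesis
    using that unfolding B_def by blast
qed

lemma mult_matrix_inv:
  fixes P :: "complex^'d^'d"
  assumes "\<And>v. P *v v = 0 \<Longrightarrow> v = 0"
  shows "P ** matrix_inv P = mat 1"
proof -
  have "invertible P"
    using assms by (simp add: invertible_left_inverse matrix_left_invertible_ker)
  then show ?thesis
    unfolding invertible_def matrix_inv_def by (rule someI_ex[THEN conjunct1])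
qed

text \<open>
  Since \<open>\<bar>l + k\<bar> \<ge> Re l + k\<close> for all \<open>k\<close>, every factor \<open>C + k I\<close> expands the adapted norm by at least
  \<open>c + k\<close>, with no exceptional initial indices. Expansion gives both the invertibility of the symbol
  and the bound for its inverse.
\<close>
lemma mat_pochhammer_inv_onorm_le:
  fixes C :: "complex^'d^'d"
  assumes "0 < c" and "c < spec_min C"
  obtains K where "0 \<le> K"
    and "\<And>k. onorm ((*v) (matrix_inv (mat_pochhammer C k))) \<le> K / pochhammer c k"
proof -
  obtain ls where ls: "\<And>v. root_prod C ls v = 0" "set ls = spectrum C" "ls \<noteq> []"
    using ex_annihilating_spectrum_list[of C] by metis
  define e where "e = spec_min C - c"
  have "0 < e"
    using assms by (simp add: e_def)
  define N where "N = adapted_norm C e ls"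
  have N0: "norm v \<le> N v" for v
    using \<open>0 < e\<close> ls(3) by (simp add: N_def norm_le_adapted_norm)
  obtain K where K: "0 < K" "\<And>v. N v \<le> K * norm v"
    using adapted_norm_le_norm[OF \<open>0 < e\<close>, of C ls] unfolding N_def by blast
  have pos: "0 < pochhammer c k" for k
    using assms(1) by (rule pochhammer_pos)
  have step: "(c + real k) * N v \<le> N (C *v v + of_nat k *s v)" for k v
  proof -
    have "spec_min C + real k \<le> norm (l + of_nat k)" if "l \<in> set ls" for l
      using spec_min_le[of l C] that ls(2) complex_Re_le_cmod[of "l + of_nat k"] by simp
    then have "(spec_min C + real k) * N v - e * (N v - norm v) \<le> N (C *v v + of_nat k *s v)"
      unfolding N_def using \<open>0 < e\<close> ls(1) by (intro adapted_norm_shift_ge) auto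
    moreover have "(c + real k) * N v \<le> (spec_min C + real k) * N v - e * (N v - norm v)"
      using assms(2) by (simp add: e_def algebra_simps mult_right_mono)
    ultimately show ?thesis
      by linarith
  qed
  have expand: "pochhammer c k * N v \<le> N (mat_pochhammer C k *v v)" for k v
  proof (induction k arbitrary: v)
    case (Suc k)
    have "pochhammer c (Suc k) * N v = pochhammer c k * ((c + real k) * N v)"
      by (simp add: pochhammer_Suc)
    also have "\<dots> \<le> pochhammer c k * N (C *v v + of_nat k *s v)"
      using pos[of k] step by (intro mult_left_mono) auto
    also have "\<dots> \<le> N (mat_pochhammer C (Suc k) *v v)"
      using Suc by (simp add: matrix_vector_mul_assoc[symmetric] add_mat_mult_vec)
    finally show ?case .
  qed simp
  have "onorm ((*v) (matrix_inv (mat_pochhammer C k))) \<le> K / pochhammer c k" for k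
  proof (rule onorm_le)
    fix v
    let ?P = "mat_pochhammer C k"
    have "w = 0" if "?P *v w = 0" for w
    proof -
      have "pochhammer c k * norm w \<le> pochhammer c k * N w"
        using pos[of k] N0 by (intro mult_left_mono) auto
      also have "\<dots> \<le> N 0"
        using expand[of k w] that by simp
      also have "\<dots> \<le> 0"
        using K(2)[of 0] by simp
      finally show ?thesis
        using pos[of k] by (simp add: mult_le_0_iff)
    qed
    then have "?P *v (matrix_inv ?P *v v) = v"
      by (simp add: matrix_vector_mul_assoc mult_matrix_inv)
    then have "pochhammer c k * N (matrix_inv ?P *v v) \<le> K * norm v"
      using expand[of k "matrix_inv ?P *v v"] K(2)[of v] by simp
    moreover have "pochhammer c k * norm (matrix_inv ?P *v v) \<le> pochhammer c k * N (matrix_inv ?P *v v)"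
      using pos[of k] N0 by (intro mult_left_mono) auto
    ultimately have "pochhammer c k * norm (matrix_inv ?P *v v) \<le> K * norm v"
      by linarith
    then show "norm (matrix_inv ?P *v v) \<le> K / pochhammer c k * norm v"
      using pos[of k] by (simp add: field_simps)
  qed
  then show ?thesis
    using that K(1) less_imp_le by blast
qed

section \<open>Norms of matrix products\<close>

lemma norm_matrix_le_onorm:
  fixes X :: "complex^'d^'d"
  shows "norm X \<le> (real CARD('d))\<^sup>2 * onorm ((*v) X)"
proof -
  have entry: "norm (X $ i $ j) \<le> onorm ((*v) X)" for i j
  proof -
    have "X $ i $ j = (X *v axis j 1) $ i"
      by (simp add: matrix_vector_mul_component axis_def inner_vec_def
          matrix_vector_mult_def if_distrib cong: if_cong)
    then have "norm (X $ i $ j) \<le> norm (X *v axis j 1)"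
      using Finite_Cartesian_Product.norm_nth_le[of "X *v axis j 1" i] by simp
    also have "\<dots> \<le> onorm ((*v) X) * norm (axis j 1 :: complex^'d)"
      by (intro onorm matrix_vector_mul_bounded_linear)
    finally show ?thesis
      by simp
  qed
  have "norm X \<le> (\<Sum>i\<in>UNIV. norm (X $ i))"
    unfolding norm_vec_def[of X] by (rule L2_set_le_sum) simp
  also have "\<dots> \<le> (\<Sum>i\<in>UNIV. \<Sum>j\<in>UNIV. norm (X $ i $ j))"
    by (intro sum_mono) (simp add: norm_vec_def L2_set_le_sum)
  also have "\<dots> \<le> (\<Sum>i\<in>(UNIV :: 'd set). \<Sum>j\<in>(UNIV :: 'd set). onorm ((*v) X))"
    by (intro sum_mono entry)
  finally show ?thesis
    by (simp add: power2_eq_square mult.assoc)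
qed

lemma onorm_matrix_mult_le:
  fixes A B :: "complex^'d^'d"
  assumes "onorm ((*v) A) \<le> a" and "onorm ((*v) B) \<le> b" and "0 \<le> a"
  shows "onorm ((*v) (A ** B)) \<le> a * b"
proof -
  have "onorm ((*v) (A ** B)) = onorm ((*v) A \<circ> (*v) B)"
    by (simp add: o_def matrix_vector_mul_assoc)
  also have "\<dots> \<le> onorm ((*v) A) * onorm ((*v) B)"
    by (intro onorm_compose matrix_vector_mul_bounded_linear)
  also have "\<dots> \<le> a * b"
    using assms by (intro mult_mono) (auto intro: onorm_pos_le)
  finally show ?thesis .
qed

lemma norm_mat_scale: "norm (mat_scale c M) = norm c * norm M"
proof -
  have "mat_scale c M $ i = c *s (M $ i)" for i
    by (simp add: mat_scale_def vec_eq_iff)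
  then show ?thesis
    by (simp add: norm_vec_def[of "mat_scale c M"] norm_vec_def[of M] norm_vector_smult
        L2_set_right_distrib)
qed

section \<open>The dominating scalar series\<close>

text \<open>
  Multiplying by \<open>1 - x\<close> lowers \<open>p\<close> by one, by Pascal's rule, up to a boundary term of favourable
  sign.
\<close>
lemma negative_binomial_partial_sum_le:
  fixes x :: real
  assumes "0 \<le> x" "x < 1"
  shows "(\<Sum>m\<le>M. real ((m + p) choose p) * x ^ m) \<le> (1 / (1 - x)) ^ Suc p"
proof (induction p)
  case 0
  have "(\<Sum>m\<le>M. x ^ m) \<le> (\<Sum>m. x ^ m)"
    using assms by (intro sum_le_suminf summable_geometric) auto
  then show ?case
    using assms by (simp add: suminf_geometric)
next
  case (Suc p)
  let ?S = "\<lambda>p. \<Sum>m\<le>M. real ((m + p) choose p) * x ^ m"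
  have "(1 - x) * ?S (Suc p) = ?S p - real ((M + Suc p) choose Suc p) * x ^ Suc M"
    by (induction M) (simp_all add: algebra_simps)
  also have "\<dots> \<le> ?S p"
    using assms by simp
  finally have "(1 - x) * ?S (Suc p) \<le> (1 / (1 - x)) ^ Suc p"
    using Suc by linarith
  then have "?S (Suc p) \<le> (1 / (1 - x)) ^ Suc p / (1 - x)"
    using assms by (simp only: pos_le_divide_eq mult.commute diff_gt_0_iff_gt)
  then show ?case
    by simp
qed

text \<open>
  All terms are nonnegative, so it suffices to bound the sums over cubes; there the sums over \<open>m\<close>
  and \<open>n\<close> factorise for fixed \<open>p\<close>.
\<close>
lemma summable_on_binomial_product:
  fixes x y z :: real
  assumes "0 \<le> x" "x < 1" "0 \<le> y" "y < 1" "0 \<le> z" "z < (1 - x) * (1 - y)"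
  shows "(\<lambda>(m, n, p). real ((m + p) choose p) * x ^ m * (real ((n + p) choose p) * y ^ n) * z ^ p)
           summable_on (UNIV :: (nat \<times> nat \<times> nat) set)"
    (is "?f summable_on _")
proof (rule nonneg_bdd_above_summable_on)
  let ?X = "1 / (1 - x)" and ?Y = "1 / (1 - y)"
  define q where "q = z / ((1 - x) * (1 - y))"
  have q: "0 \<le> q" "q < 1"
    using assms by (simp_all add: q_def)
  have "sum ?f F \<le> ?X * ?Y / (1 - q)" if "finite F" for F
  proof -
    define T where "T = fst ` F \<union> fst ` snd ` F \<union> snd ` snd ` F"
    have "finite T"
      using that by (simp add: T_def)
    then obtain N where "\<forall>k\<in>T. k \<le> N"
      by (auto simp: finite_nat_set_iff_bounded_le)
    then have N: "F \<subseteq> {..N} \<times> {..N} \<times> {..N}"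
      by (fastforce simp: T_def image_iff)
    have "sum ?f F \<le> sum ?f ({..N} \<times> {..N} \<times> {..N})"
      using N assms by (intro sum_mono2) auto
    also have "\<dots> = (\<Sum>m\<le>N. \<Sum>n\<le>N. \<Sum>p\<le>N. ?f (m, n, p))"
      by (simp add: sum.cartesian_product)
    also have "\<dots> = (\<Sum>m\<le>N. \<Sum>p\<le>N. \<Sum>n\<le>N. ?f (m, n, p))"
      by (intro sum.cong refl sum.swap)
    also have "\<dots> = (\<Sum>p\<le>N. \<Sum>m\<le>N. \<Sum>n\<le>N. ?f (m, n, p))"
      by (rule sum.swap)
    also have "\<dots> = (\<Sum>p\<le>N. (\<Sum>m\<le>N. real ((m + p) choose p) * x ^ m)
                  * (\<Sum>n\<le>N. real ((n + p) choose p) * y ^ n) * z ^ p)"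
      by (simp only: prod.case sum_product) (simp only: sum_distrib_right)
    also have "\<dots> \<le> (\<Sum>p\<le>N. ?X ^ Suc p * ?Y ^ Suc p * z ^ p)"
      using assms
      by (intro sum_mono mult_right_mono mult_mono negative_binomial_partial_sum_le)
        (auto intro!: sum_nonneg)
    also have "\<dots> = ?X * ?Y * (\<Sum>p\<le>N. q ^ p)"
      unfolding sum_distrib_left
      by (intro sum.cong refl) (simp add: q_def power_divide power_mult_distrib)
    also have "\<dots> \<le> ?X * ?Y * (\<Sum>p. q ^ p)"
      using q assms by (intro mult_left_mono sum_le_suminf summable_geometric) auto
    also have "\<dots> = ?X * ?Y / (1 - q)"
      using q by (simp add: suminf_geometric)
    finally show ?thesis .
  qed
  then show "bdd_above (sum ?f ` {F. F \<subseteq> UNIV \<and> finite F})"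
    by (auto intro!: bdd_aboveI)
qed (use assms in auto)

section \<open>Convergence\<close>

theorem theorem4p1:
  fixes A1 A2 B1 B2 C1 C2 C3 :: "complex^'d^'d"
    and r s t :: real
    and x y z :: complex
  assumes "positive_stable A1" and "positive_stable A2"
    and "positive_stable B1" and "positive_stable B2"
    and "positive_stable C1" and "positive_stable C2" and "positive_stable C3"
    and "spec_max A1 < spec_min C1"
    and "spec_max A2 < 1"
    and "spec_max B1 < 1"
    and "spec_max B2 < spec_min C2"
    and "spec_min C3 > 1"
    and "r > 0" and "s > 0" and "t > 0"
    and "r < 1" and "s < 1" and "(1 - r) * (1 - s) = t"
    and "norm x < r" and "norm y < s" and "norm z < t"
  shows "(\<lambda>(m, n, p). norm (F3_term A1 A2 B1 B2 C1 C2 C3 x y z m n p))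
           summable_on (UNIV :: (nat \<times> nat \<times> nat) set)"
proof -
  \<comment> \<open>The scalar Pochhammer symbols belonging to the same number cancel in the estimate of a term.\<close>
  define a where "a = (spec_max A1 + spec_min C1) / 2"
  define b where "b = (spec_max B2 + spec_min C2) / 2"
  have pos_ab: "0 < spec_max A1" "0 < spec_max B2"
    using assms(1,4) spec_min_le_spec_max unfolding positive_stable_def by (meson less_le_trans)+
  have a: "0 < a" "spec_max A1 < a" "a < spec_min C1"
    and b: "0 < b" "spec_max B2 < b" "b < spec_min C2"
    using pos_ab assms(8,11) by (simp_all add: a_def b_def)
  have pos: "0 < pochhammer a k" "0 < pochhammer b k" for k
    using a b by (simp_all add: pochhammer_pos)
  obtain KA1 where KA1: "0 \<le> KA1" "\<And>k. onorm ((*v) (mat_pochhammer A1 k)) \<le> KA1 * pochhammer a k"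
    using mat_pochhammer_onorm_le[OF a(1,2)] by metis
  obtain KA2 where KA2: "0 \<le> KA2" "\<And>k. onorm ((*v) (mat_pochhammer A2 k)) \<le> KA2 * pochhammer 1 k"
    using mat_pochhammer_onorm_le[OF zero_less_one assms(9)] by metis
  obtain KB1 where KB1: "0 \<le> KB1" "\<And>k. onorm ((*v) (mat_pochhammer B1 k)) \<le> KB1 * pochhammer 1 k"
    using mat_pochhammer_onorm_le[OF zero_less_one assms(10)] by metis
  obtain KB2 where KB2: "0 \<le> KB2" "\<And>k. onorm ((*v) (mat_pochhammer B2 k)) \<le> KB2 * pochhammer b k"
    using mat_pochhammer_onorm_le[OF b(1,2)] by metis
  obtain KC1 where KC1: "0 \<le> KC1"
    "\<And>k. onorm ((*v) (matrix_inv (mat_pochhammer C1 k))) \<le> KC1 / pochhammer a k"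
    using mat_pochhammer_inv_onorm_le[OF a(1,3)] by metis
  obtain KC2 where KC2: "0 \<le> KC2"
    "\<And>k. onorm ((*v) (matrix_inv (mat_pochhammer C2 k))) \<le> KC2 / pochhammer b k"
    using mat_pochhammer_inv_onorm_le[OF b(1,3)] by metis
  obtain KC3 where KC3: "0 \<le> KC3"
    "\<And>k. onorm ((*v) (matrix_inv (mat_pochhammer C3 k))) \<le> KC3 / pochhammer 1 k"
    using mat_pochhammer_inv_onorm_le[OF zero_less_one assms(12)] by metis
  define K where "K = (real CARD('d))\<^sup>2 * (KA1 * KA2 * KB1 * KB2 * KC1 * KC2 * KC3)"
  define f where "f = (\<lambda>(m, n, p). real ((m + p) choose p) * norm x ^ m
                        * (real ((n + p) choose p) * norm y ^ n) * norm z ^ p)"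
  have term_le: "norm (F3_term A1 A2 B1 B2 C1 C2 C3 x y z m n p) \<le> K * f (m, n, p)" for m n p
  proof -
    define P where "P = mat_pochhammer A1 m ** mat_pochhammer A2 (n + p)
        ** mat_pochhammer B1 (m + p) ** mat_pochhammer B2 n
        ** matrix_inv (mat_pochhammer C1 m)
        ** matrix_inv (mat_pochhammer C2 n)
        ** matrix_inv (mat_pochhammer C3 p)"
    define Q where "Q = KA1 * pochhammer a m * (KA2 * pochhammer 1 (n + p))
        * (KB1 * pochhammer 1 (m + p)) * (KB2 * pochhammer b n)
        * (KC1 / pochhammer a m) * (KC2 / pochhammer b n) * (KC3 / pochhammer 1 p)"
    have "norm P \<le> (real CARD('d))\<^sup>2 * onorm ((*v) P)"
      by (rule norm_matrix_le_onorm)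
    also have "\<dots> \<le> (real CARD('d))\<^sup>2 * Q"
      unfolding P_def Q_def
      by (intro mult_left_mono onorm_matrix_mult_le KA1 KA2 KB1 KB2 KC1 KC2 KC3
          mult_nonneg_nonneg divide_nonneg_pos pos[THEN less_imp_le] pos)
        (simp_all add: pochhammer_fact[symmetric])
    also have "\<dots> = K * (fact (n + p) * fact (m + p) / fact p)"
      using pos[of m] pos[of n] by (simp add: K_def Q_def pochhammer_fact[symmetric])
    finally have "norm P \<le> K * (fact (n + p) * fact (m + p) / fact p)" .
    then have "norm (F3_term A1 A2 B1 B2 C1 C2 C3 x y z m n p)
        \<le> norm (x ^ m * y ^ n * z ^ p / (fact m * fact n * fact p))
           * (K * (fact (n + p) * fact (m + p) / fact p))"
      unfolding F3_term_def norm_mat_scale P_def by (intro mult_left_mono) auto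
    also have "\<dots> = K * f (m, n, p)"
    proof -
      have "real ((m + p) choose p) = fact (m + p) / (fact p * fact m)"
        and "real ((n + p) choose p) = fact (n + p) / (fact p * fact n)"
        by (simp_all add: binomial_fact)
      then show ?thesis
        unfolding f_def by (simp add: norm_mult norm_divide norm_power mult_ac)
    qed
    finally show ?thesis .
  qed
  have "(1 - r) * (1 - s) \<le> (1 - norm x) * (1 - norm y)"
    using assms by (intro mult_mono) auto
  then have "f summable_on UNIV"
    unfolding f_def using assms by (intro summable_on_binomial_product) auto
  then have "(\<lambda>i. K * f i) summable_on UNIV"
    by (rule summable_on_cmult_right)
  then show ?thesis
    by (rule summable_on_comparison_test) (use term_le in auto)
qed

end
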